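(* Let $R$ be a finite commutative von Neumann regular ring such that the graph $\Gamma'_{Reg}(R)$ is a nontrivial connected graph. Then $$\operatorname{girth}(\Gamma'_{Reg}(R))=\begin{cases}\infty, & \text{if } R\cong\mathbb{F}_2\times\mathbb{F}_2\text{ or } R\cong\mathbb{F}_2\times\mathbb{F}_3,\\ 8, & \text{if } R\cong\mathbb{F}_3\times\mathbb{F}_3,\\ 3, & \text{otherwise.}\end{cases}$$
   Context: All rings have an identity. A ring $R$ is von Neumann regular if for every $x\in R$ there is $y\in R$ with $xyx=x$. For such $R$, $\Gamma'_{Reg}(R)$ is the simple graph with vertex set $R\setminus\{0_R\}$ in which two distinct vertices $a,b$ are adjacent if and only if $aba=a$ or $bab=b$. A graph is nontrivial if it has at least two vertices. The girth is the length of a shortest cycle, and is $\infty$ if there are no cycles. $\mathbb{F}_q$ denotes the field with $q$ elements. *)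

theory Defs
  imports
    "HOL-Library.Extended_Nat"
    "HOL-Number_Theory.Residues"
    "HOL-Algebra.Chinese_Remainder"
    "Graph_Theory.Digraph_Component"
begin

definition von_neumann_regular :: "('a, 'b) ring_scheme \<Rightarrow> bool" where
  "von_neumann_regular R \<longleftrightarrow>
     ring R \<and> (\<forall>x \<in> carrier R. \<exists>y \<in> carrier R. x \<otimes>\<^bsub>R\<^esub> y \<otimes>\<^bsub>R\<^esub> x = x)"

text \<open>Simple graphs are represented as loop-free symmetric digraphs without parallel arcs.\<close>

definition regular_graph :: "('a, 'b) ring_scheme \<Rightarrow> 'a pair_pre_digraph" where
  "regular_graph R =
     \<lparr> pverts = carrier R - {\<zero>\<^bsub>R\<^esub>},
       parcs = {(a, b). a \<in> carrier R - {\<zero>\<^bsub>R\<^esub>} \<and> b \<in> carrier R - {\<zero>\<^bsub>R\<^esub>} \<and> a \<noteq> b \<and>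
                 (a \<otimes>\<^bsub>R\<^esub> b \<otimes>\<^bsub>R\<^esub> a = a \<or> b \<otimes>\<^bsub>R\<^esub> a \<otimes>\<^bsub>R\<^esub> b = b)} \<rparr>"

lemma pair_bidirected_digraph_regular_graph: "pair_bidirected_digraph (regular_graph R)"
  by unfold_locales (auto simp: regular_graph_def symmetric_def sym_def)

lemma pair_graph_regular_graph:
  assumes "finite (carrier R)"
  shows "pair_graph (regular_graph R)"
proof -
  interpret pair_bidirected_digraph "regular_graph R"
    by (rule pair_bidirected_digraph_regular_graph)
  have fin: "finite (pverts (regular_graph R))"
    using assms by (simp add: regular_graph_def)
  have "parcs (regular_graph R) \<subseteq> pverts (regular_graph R) \<times> pverts (regular_graph R)"
    by (auto simp: regular_graph_def)
  then have "finite (parcs (regular_graph R))"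
    using fin by (meson finite_SigmaI finite_subset)
  with fin show ?thesis by unfold_locales
qed

definition nontrivial_graph :: "'a pair_pre_digraph \<Rightarrow> bool" where
  "nontrivial_graph G \<longleftrightarrow> (\<exists>u \<in> pverts G. \<exists>v \<in> pverts G. u \<noteq> v)"

text \<open>
  In a symmetric digraph, traversing an edge back and forth is a directed cycle of length 2.
  The directed cycles of length at least 3 are exactly the cycles of the simple graph.
  The infimum of the empty set in \<^typ>\<open>enat\<close> is \<^term>\<open>\<infinity> :: enat\<close>.
\<close>

definition girth :: "'a pair_pre_digraph \<Rightarrow> enat" where
  "girth G = (INF p \<in> {p. pre_digraph.cycle (with_proj G) p \<and> 3 \<le> length p}. enat (length p))"

lemma girth_acyclic:
  assumes "\<And>p. pre_digraph.cycle (with_proj G) p \<Longrightarrow> length p < 3"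
  shows "girth G = \<infinity>"
proof -
  have "{p. pre_digraph.cycle (with_proj G) p \<and> 3 \<le> length p} = {}"
    using assms by fastforce
  then show ?thesis unfolding girth_def by (simp only: image_empty Inf_empty top_enat_def)
qed

end

theory Submission
  imports Defs
begin

text \<open>
  A neighbour of the identity is an idempotent $e \neq 0, 1$; put $f = 1 - e$. Triangles arise in
  two ways: from a chain of idempotents $g < e < 1$, and from $x, y \in eR$ with $xy = e$ and
  $x \neq y$, where $x + f$, $y + f$ and $f$ are pairwise adjacent. If there is no triangle, then
  $eR$ is therefore a field in which $x^2 = e$ for all $x \neq 0$, so $eR = \{0, e, -e\}$;
  likewise for $fR$, and $R = eR \times fR$ is one of the three exceptional rings.
  The graphs of these rings are two paths and a cycle of length 8.
\<close>

section \<open>Cycles\<close>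

text \<open>The tail of the vertex list of a walk is the list of heads of its arcs. Hence the
  distinctness demanded of a cycle becomes a condition on \<open>map snd p\<close> alone, as used in
  \<open>cycle_with_proj_iff\<close>.\<close>

lemma pawalk_verts_conv_snd: "pcas u p v \<Longrightarrow> pawalk_verts u p = u # map snd p"
  by (induction p arbitrary: u) auto

lemma cycle_with_proj_iff:
  "pre_digraph.cycle (with_proj G) p \<longleftrightarrow>
     (\<exists>u \<in> pverts G. p \<noteq> [] \<and> set p \<subseteq> parcs G \<and> pcas u p u \<and> distinct (map snd p))"
  unfolding pre_digraph.cycle_def pre_digraph.awalk_def
  by (auto simp: cas_with_proj_eq awalk_verts_with_proj_eq pawalk_verts_conv_snd)

lemma pcas_nth:
  "pcas u p v \<Longrightarrow> i < length p \<Longrightarrow> fst (p ! i) = (if i = 0 then u else snd (p ! (i - 1)))"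
  by (induction p arbitrary: u i) (auto simp: nth_Cons split: nat.splits)

lemma pcas_last: "pcas u p v \<Longrightarrow> p \<noteq> [] \<Longrightarrow> v = snd (last p)"
  by (induction p arbitrary: u) auto

text \<open>The vertices \<open>a\<close> and \<open>b\<close> are the predecessor and the successor
  of \<open>v\<close> on the cycle. The lemma excludes vertices of degree at most one from every
  cycle, and forces both neighbours of a vertex of degree two onto any cycle through it.\<close>

lemma cycle_two_neighbours:
  assumes "pre_digraph.cycle (with_proj G) p" and "3 \<le> length p" and "v \<in> snd ` set p"
  obtains a b where "a \<in> snd ` set p" "b \<in> snd ` set p" "a \<noteq> b" "(a, v) \<in> parcs G" "(v, b) \<in> parcs G"
proof -
  obtain u where p: "p \<noteq> []" "set p \<subseteq> parcs G" "pcas u p u" "distinct (map snd p)"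
    using assms(1) by (auto simp: cycle_with_proj_iff)
  define n where "n = length p"
  have n: "3 \<le> n" using assms(2) by (simp add: n_def)
  \<comment> \<open>Cyclic predecessor of an index: the walk is closed, so position 0 is preceded by
    n - 1.\<close>
  define pre where "pre i = (if i = 0 then n - 1 else i - 1)" for i
  have fst_nth: "fst (p ! i) = snd (p ! pre i)" if "i < n" for i
    using pcas_nth[OF p(3)] pcas_last[OF p(3,1)] that p(1)
    by (auto simp: pre_def n_def last_conv_nth)
  obtain i where i: "i < n" "v = snd (p ! i)"
    using assms(3) by (auto simp: in_set_conv_nth n_def)
  define j where "j = (if Suc i = n then 0 else Suc i)"
  have j: "j < n" "pre j = i" using i n by (auto simp: j_def pre_def)
  \<comment> \<open>Here n \<ge> 3 is essential: on a closed walk of length 2 the predecessor and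
    the successor coincide.\<close>
  have k: "pre i < n" "pre i \<noteq> j" using i n by (auto simp: j_def pre_def split: if_splits)
  have arc: "p ! l \<in> parcs G" if "l < n" for l
    using p(2) that by (auto simp: n_def)
  show thesis
  proof
    show "snd (p ! pre i) \<in> snd ` set p" "snd (p ! j) \<in> snd ` set p"
      using j k by (auto simp: n_def)
    show "snd (p ! pre i) \<noteq> snd (p ! j)"
      using p(4) j(1) k by (auto simp: distinct_conv_nth n_def)
    show "(snd (p ! pre i), v) \<in> parcs G"
      using arc[OF i(1)] fst_nth[OF i(1)] i(2) by (metis prod.collapse)
    show "(v, snd (p ! j)) \<in> parcs G"
      using arc[OF j(1)] fst_nth[OF j(1)] i(2) j(2) by (metis prod.collapse)
  qed
qed

section \<open>Bounds for the girth and its behaviour under injective homomorphisms\<close>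

lemma girth_le_length:
  assumes "pre_digraph.cycle (with_proj G) p" and "3 \<le> length p"
  shows "girth G \<le> enat (length p)"
  unfolding girth_def using assms by (auto intro: INF_lower)

lemma girth_ge_iff:
  "k \<le> girth G \<longleftrightarrow>
     (\<forall>p. pre_digraph.cycle (with_proj G) p \<and> 3 \<le> length p \<longrightarrow> k \<le> enat (length p))"
  unfolding girth_def by (auto simp: le_INF_iff)

lemma girth_eq_3:
  assumes "a \<in> pverts G" "(a, b) \<in> parcs G" "(b, c) \<in> parcs G" "(c, a) \<in> parcs G"
    and "a \<noteq> b" "b \<noteq> c" "c \<noteq> a"
  shows "girth G = 3"
proof (rule antisym)
  have "pre_digraph.cycle (with_proj G) [(a, b), (b, c), (c, a)]"
    using assms by (auto simp: cycle_with_proj_iff)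
  from girth_le_length[OF this] show "girth G \<le> 3"
    by (simp add: numeral_eq_enat numeral_3_eq_3)
  show "3 \<le> girth G"
    by (auto simp: girth_ge_iff numeral_eq_enat)
qed

text \<open>The arcwise image of a cycle is a closed walk of the same length, and injectivity keeps
  its heads distinct.\<close>

lemma girth_le_of_inj_hom:
  assumes "wf_digraph (with_proj G)" and "inj_on f (pverts G)"
    and "\<And>u. u \<in> pverts G \<Longrightarrow> f u \<in> pverts H"
    and "\<And>u v. (u, v) \<in> parcs G \<Longrightarrow> (f u, f v) \<in> parcs H"
  shows "girth H \<le> girth G"
  unfolding girth_ge_iff
proof (intro allI impI, elim conjE)
  fix p assume p: "pre_digraph.cycle (with_proj G) p" "3 \<le> length p"
  then obtain u where u: "u \<in> pverts G" "p \<noteq> []" "set p \<subseteq> parcs G" "pcas u p u" "distinct (map snd p)"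
    by (auto simp: cycle_with_proj_iff)
  interpret wf_digraph "with_proj G" by fact
  let ?q = "map (map_prod f f) p"
  have pcas: "pcas (f a) (map (map_prod f f) q) (f b)" if "pcas a q b" for a b q
    using that by (induction q arbitrary: a) auto
  have "snd ` set p \<subseteq> pverts G"
    using u(3) head_in_verts by force
  then have "distinct (map snd ?q)"
    using u(5) inj_on_subset[OF assms(2)]
    by (simp add: distinct_map comp_inj_on image_comp flip: comp_def)
  moreover have "set ?q \<subseteq> parcs H"
    using u(3) assms(4) by auto
  ultimately have "pre_digraph.cycle (with_proj H) ?q"
    using u assms(3) pcas[OF u(4)] unfolding cycle_with_proj_iff by auto
  from girth_le_length[OF this] p(2) show "girth H \<le> enat (length p)" by simp
qed

text \<open>Connectedness means reachability in the symmetric closure, so the first step of a walk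
  from \<open>u\<close> to \<open>v\<close> is an arc in one of the two directions.\<close>

lemma connected_imp_neighbour:
  assumes "Digraph_Component.connected (with_proj G)" "u \<in> pverts G" "v \<in> pverts G" "u \<noteq> v"
  shows "\<exists>w. (u, w) \<in> parcs G \<or> (w, u) \<in> parcs G"
proof -
  have "(u, v) \<in> rtrancl_on (pverts (mk_symmetric (with_proj G))) (parcs (mk_symmetric (with_proj G)))"
    using assms(1-3) by (auto simp: Digraph_Component.connected_def strongly_connected_def reachable_def)
  then show ?thesis
    using assms(4) by (cases rule: converse_rtrancl_on_cases) (auto simp: parcs_mk_symmetric)
qed

section \<open>The graph of a product of two residue rings\<close>

lemma wf_digraph_regular_graph: "wf_digraph (with_proj (regular_graph R))"
  by unfold_locales (auto simp: regular_graph_def)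

text \<open>An isomorphism preserves being nonzero and the equation aba = a, so it embeds one graph
  in the other. The reverse inequality comes from the inverse isomorphism.\<close>

lemma girth_regular_graph_le_of_ring_iso:
  assumes "ring R" "ring S" "h \<in> ring_iso R S"
  shows "girth (regular_graph S) \<le> girth (regular_graph R)"
proof (rule girth_le_of_inj_hom[OF wf_digraph_regular_graph])
  interpret R: ring R by fact
  have bij: "bij_betw h (carrier R) (carrier S)" and hom: "h \<in> ring_hom R S"
    using assms(3) by (auto simp: ring_iso_def)
  have inj: "h x = h y \<longleftrightarrow> x = y" if "x \<in> carrier R" "y \<in> carrier R" for x y
    using bij that by (auto simp: bij_betw_def inj_on_def)
  have zero: "h \<zero>\<^bsub>R\<^esub> = \<zero>\<^bsub>S\<^esub>"
    using ring_hom_zero[OF hom assms(1,2)] .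
  have nz: "h x \<noteq> \<zero>\<^bsub>S\<^esub>" if "x \<in> carrier R" "x \<noteq> \<zero>\<^bsub>R\<^esub>" for x
    using inj[OF that(1) R.zero_closed] that zero by auto
  have mult: "h x \<otimes>\<^bsub>S\<^esub> h y \<otimes>\<^bsub>S\<^esub> h x = h (x \<otimes>\<^bsub>R\<^esub> y \<otimes>\<^bsub>R\<^esub> x)"
    if "x \<in> carrier R" "y \<in> carrier R" for x y
    using that by (simp add: ring_hom_mult[OF hom])
  show "inj_on h (pverts (regular_graph R))"
    using inj by (auto simp: regular_graph_def inj_on_def)
  show "h u \<in> pverts (regular_graph S)" if "u \<in> pverts (regular_graph R)" for u
    using that nz ring_hom_closed[OF hom] by (auto simp: regular_graph_def)
  show "(h u, h v) \<in> parcs (regular_graph S)" if "(u, v) \<in> parcs (regular_graph R)" for u v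
    using that nz ring_hom_closed[OF hom] by (auto simp: regular_graph_def mult inj)
qed

lemma girth_regular_graph_ring_iso:
  assumes "ring R" "ring S" "R \<simeq> S"
  shows "girth (regular_graph R) = girth (regular_graph S)"
proof (rule antisym)
  show "girth (regular_graph S) \<le> girth (regular_graph R)"
    using assms girth_regular_graph_le_of_ring_iso by (auto simp: is_ring_iso_def)
  show "girth (regular_graph R) \<le> girth (regular_graph S)"
    using assms ring_iso_sym[OF assms(1,3)] girth_regular_graph_le_of_ring_iso
    by (auto simp: is_ring_iso_def)
qed

section \<open>The girths of the three exceptional graphs\<close>

lemma ring_residue_ring: "1 < m \<Longrightarrow> ring (residue_ring m)"
  using residues.cring[of m] by (simp add: residues_def cring.axioms)

abbreviation residue_prod :: "int \<Rightarrow> int \<Rightarrow> (int \<times> int) ring" where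
  "residue_prod m n \<equiv> RDirProd (residue_ring m) (residue_ring n)"

lemma residue_prod_simps:
  "carrier (residue_prod m n) = {0..m - 1} \<times> {0..n - 1}"
  "\<zero>\<^bsub>residue_prod m n\<^esub> = (0, 0)"
  "\<one>\<^bsub>residue_prod m n\<^esub> = (1, 1)"
  "x \<otimes>\<^bsub>residue_prod m n\<^esub> y = (fst x * fst y mod m, snd x * snd y mod n)"
  "x \<oplus>\<^bsub>residue_prod m n\<^esub> y = ((fst x + fst y) mod m, (snd x + snd y) mod n)"
  by (auto simp: RDirProd_def DirProd_def monoid.defs residue_ring_def split: prod.splits)

lemma ring_residue_prod: "1 < m \<Longrightarrow> 1 < n \<Longrightarrow> ring (residue_prod m n)"
  by (simp add: RDirProd_ring ring_residue_ring)

text \<open>Filtering explicit lists makes the arc set computable by \<open>code_simp\<close> once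
  the moduli are numerals.\<close>

lemma parcs_residue_prod:
  "parcs (regular_graph (residue_prod m n)) =
     (let V = filter (\<lambda>v. v \<noteq> (0, 0)) (List.product [0..m - 1] [0..n - 1])
      in set (filter (\<lambda>((i, j), (k, l)). (i, j) \<noteq> (k, l) \<and>
           (i * k * i mod m = i \<and> j * l * j mod n = j \<or> k * i * k mod m = k \<and> l * j * l mod n = l))
         (List.product V V)))"
  unfolding regular_graph_def residue_prod_simps Let_def
  by (rule Set.set_eqI) (simp add: split_beta mem_Times_iff mod_simps prod_eq_iff)

lemma cycle_verts_subset:
  assumes "pre_digraph.cycle (with_proj (regular_graph R)) p"
  shows "snd ` set p \<subseteq> carrier R - {\<zero>\<^bsub>R\<^esub>}"
  using assms by (auto simp: cycle_with_proj_iff regular_graph_def)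

lemma cycle_verts_residue_prod:
  assumes "pre_digraph.cycle (with_proj (regular_graph (residue_prod m n))) p"
  shows "snd ` set p \<subseteq> set (filter (\<lambda>v. v \<noteq> (0, 0)) (List.product [0..m - 1] [0..n - 1]))"
  using cycle_verts_subset[OF assms] by (auto simp: residue_prod_simps)

text \<open>The graph is the path (0,1) - (1,1) - (1,0).\<close>

lemma girth_residue_prod_2_2: "girth (regular_graph (residue_prod 2 2)) = \<infinity>"
proof (rule girth_acyclic, rule ccontr)
  let ?G = "regular_graph (residue_prod 2 2)"
  fix p assume p: "pre_digraph.cycle (with_proj ?G) p" "\<not> length p < 3"
  define C where "C = snd ` set p"
  have C: "C \<subseteq> {(0, 1), (1, 0), (1, 1)}"
    unfolding C_def by (rule order_trans[OF cycle_verts_residue_prod[OF p(1)]]) code_simp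
  have arcs: "parcs ?G = {((0,1),(1,1)), ((1,1),(0,1)), ((1,0),(1,1)), ((1,1),(1,0))}"
    unfolding parcs_residue_prod by code_simp
  have len: "3 \<le> length p"
    using p(2) by simp
  note nb = cycle_two_neighbours[OF p(1) len, folded C_def, unfolded arcs]
  \<comment> \<open>The ends of the path have one neighbour each; once they are excluded, the middle
    vertex has no neighbour left in \<open>C\<close>.\<close>
  have "(0, 1) \<notin> C" "(1, 0) \<notin> C"
    by - (rule notI, erule nb, force)+
  moreover from this have "(1, 1) \<notin> C"
    by - (rule notI, erule nb, force)+
  ultimately have "C = {}" using C by blast
  then show False using p(2) by (simp add: C_def)
qed

text \<open>The graph is the path (0,1) - (1,1) - (1,0) - (1,2) - (0,2); its vertices are again
  discarded from the ends inwards.\<close>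

lemma girth_residue_prod_2_3: "girth (regular_graph (residue_prod 2 3)) = \<infinity>"
proof (rule girth_acyclic, rule ccontr)
  let ?G = "regular_graph (residue_prod 2 3)"
  fix p assume p: "pre_digraph.cycle (with_proj ?G) p" "\<not> length p < 3"
  define C where "C = snd ` set p"
  have C: "C \<subseteq> {(0, 1), (0, 2), (1, 0), (1, 1), (1, 2)}"
    unfolding C_def by (rule order_trans[OF cycle_verts_residue_prod[OF p(1)]]) code_simp
  have arcs: "parcs ?G = {((0,1),(1,1)), ((1,1),(0,1)), ((0,2),(1,2)), ((1,2),(0,2)),
     ((1,0),(1,1)), ((1,1),(1,0)), ((1,0),(1,2)), ((1,2),(1,0))}"
    unfolding parcs_residue_prod by code_simp
  have len: "3 \<le> length p"
    using p(2) by simp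
  note nb = cycle_two_neighbours[OF p(1) len, folded C_def, unfolded arcs]
  have "(0, 1) \<notin> C" "(0, 2) \<notin> C"
    by - (rule notI, erule nb, force)+
  moreover from this have "(1, 1) \<notin> C" "(1, 2) \<notin> C"
    by - (rule notI, erule nb, force)+
  moreover from this have "(1, 0) \<notin> C"
    by - (rule notI, erule nb, force)+
  ultimately have "C = {}" using C by blast
  then show False using p(2) by (simp add: C_def)
qed

lemma girth_residue_prod_3_3: "girth (regular_graph (residue_prod 3 3)) = 8"
proof (rule antisym)
  let ?G = "regular_graph (residue_prod 3 3)"
  let ?p = "[((1,1),(1,0)), ((1,0),(1,2)), ((1,2),(0,2)), ((0,2),(2,2)),
     ((2,2),(2,0)), ((2,0),(2,1)), ((2,1),(0,1)), ((0,1),(1,1))] :: ((int \<times> int) \<times> (int \<times> int)) list"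
  \<comment> \<open>The graph is exactly the 8-cycle \<open>?p\<close>: each of its edges
    contributes one arc of \<open>?p\<close> and the reversed arc.\<close>
  have arcs: "parcs ?G = set ?p \<union> prod.swap ` set ?p"
    unfolding parcs_residue_prod by code_simp
  have "pre_digraph.cycle (with_proj ?G) ?p"
    unfolding cycle_with_proj_iff arcs
    by (auto simp: regular_graph_def residue_prod_simps)
  from girth_le_length[OF this] show "girth ?G \<le> 8"
    by (simp add: numeral_eq_enat eval_nat_numeral)
  show "8 \<le> girth ?G"
    unfolding girth_ge_iff
  proof (intro allI impI, elim conjE)
    fix p assume p: "pre_digraph.cycle (with_proj ?G) p" "3 \<le> length p"
    define C where "C = snd ` set p"
    note nb = cycle_two_neighbours[OF p, folded C_def,
        unfolded arcs list.set image_insert image_empty swap_simp Un_insert_left sup_bot_left]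
    \<comment> \<open>Every vertex has degree two, so a cycle through it contains both neighbours,
      in particular the next vertex along \<open>?p\<close>. A cycle that meets \<open>?p\<close>
      therefore goes all the way round.\<close>
    have steps: "(1,1) \<in> C \<Longrightarrow> (1,0) \<in> C"
      "(1,0) \<in> C \<Longrightarrow> (1,2) \<in> C"
      "(1,2) \<in> C \<Longrightarrow> (0,2) \<in> C"
      "(0,2) \<in> C \<Longrightarrow> (2,2) \<in> C"
      "(2,2) \<in> C \<Longrightarrow> (2,0) \<in> C"
      "(2,0) \<in> C \<Longrightarrow> (2,1) \<in> C"
      "(2,1) \<in> C \<Longrightarrow> (0,1) \<in> C"
      "(0,1) \<in> C \<Longrightarrow> (1,1) \<in> C"
      by (erule nb, force)+
    have "C \<subseteq> set (map snd ?p)"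
      unfolding C_def by (rule order_trans[OF cycle_verts_residue_prod[OF p(1)]]) code_simp
    moreover have "C \<noteq> {}"
      using p(2) by (auto simp: C_def)
    ultimately obtain x where "x \<in> C" "x \<in> set (map snd ?p)"
      by blast
    then have "set (map snd ?p) \<subseteq> C"
      using steps by auto
    then have "card (set (map snd ?p)) \<le> card C"
      by (intro card_mono) (auto simp: C_def)
    also have "\<dots> \<le> length p"
      using card_image_le[of "set p" snd] card_length[of p] by (simp add: C_def)
    finally show "8 \<le> enat (length p)"
      by (simp add: numeral_eq_enat)
  qed
qed

section \<open>Regular rings without triangles\<close>

context cring
begin

lemma regular_graph_arcI:
  assumes "a \<in> carrier R" "b \<in> carrier R" "a \<noteq> \<zero>" "b \<noteq> \<zero>" "a \<noteq> b" "a \<otimes> b \<otimes> a = a"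
  shows "(a, b) \<in> parcs (regular_graph R)" "(b, a) \<in> parcs (regular_graph R)"
  using assms by (auto simp: regular_graph_def)

text \<open>Of the two adjacency conditions, 1w1 = 1 would give w = 1, which is excluded; the other,
  w1w = w, says that \<open>w\<close> is idempotent.\<close>

lemma idempotent_of_one_arc:
  assumes "(\<one>, w) \<in> parcs (regular_graph R) \<or> (w, \<one>) \<in> parcs (regular_graph R)"
  shows "w \<in> carrier R" "w \<otimes> w = w" "w \<noteq> \<zero>" "w \<noteq> \<one>"
  using assms by (auto simp: regular_graph_def)

lemma idempotent_complement:
  assumes "e \<in> carrier R" "e \<otimes> e = e"
  shows "(\<one> \<ominus> e) \<otimes> (\<one> \<ominus> e) = \<one> \<ominus> e" "e \<otimes> (\<one> \<ominus> e) = \<zero>" "e \<oplus> (\<one> \<ominus> e) = \<one>"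
proof -
  show *: "e \<otimes> (\<one> \<ominus> e) = \<zero>"
    using assms by (simp add: minus_eq r_distr r_minus r_neg)
  have "(\<one> \<ominus> e) \<otimes> (\<one> \<ominus> e) = (\<one> \<ominus> e) \<ominus> e \<otimes> (\<one> \<ominus> e)"
    using assms(1) by algebra
  then show "(\<one> \<ominus> e) \<otimes> (\<one> \<ominus> e) = \<one> \<ominus> e"
    using assms(1) * by (simp add: minus_eq)
  show "e \<oplus> (\<one> \<ominus> e) = \<one>"
    using assms(1) by algebra
qed

lemma corner_of_triangle_free:
  assumes regular: "von_neumann_regular R" and no_triangle: "girth (regular_graph R) \<noteq> 3"
    and e: "e \<in> carrier R" "e \<otimes> e = e" "e \<noteq> \<zero>" "e \<noteq> \<one>"
    and x: "x \<in> carrier R"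
  shows "e \<otimes> x \<in> {\<zero>, e, \<ominus> e}"
proof -
  define f where "f = \<one> \<ominus> e"
  have f: "f \<in> carrier R" "f \<otimes> f = f" "e \<otimes> f = \<zero>" "e \<oplus> f = \<one>"
    using idempotent_complement[OF e(1,2)] e(1) by (simp_all add: f_def)
  have "f \<noteq> \<zero>"
    using f(4) e(1,4) by auto
  have no_3: False
    if "a \<in> carrier R" "b \<in> carrier R" "c \<in> carrier R"
      and "a \<noteq> \<zero>" "b \<noteq> \<zero>" "c \<noteq> \<zero>" "a \<noteq> b" "b \<noteq> c" "c \<noteq> a"
      and "a \<otimes> b \<otimes> a = a" "c \<otimes> b \<otimes> c = c" "c \<otimes> a \<otimes> c = c" for a b c
    using that girth_eq_3[of a "regular_graph R" b c] no_triangle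
    by (auto simp: regular_graph_arcI regular_graph_def)
  \<comment> \<open>Otherwise \<open>e\<close>, 1 and \<open>g\<close> would form a triangle, since
    g = ge makes \<open>g\<close> adjacent to \<open>e\<close>.\<close>
  have minimal: "g = e" if g: "g \<in> carrier R" "g \<otimes> g = g" "e \<otimes> g = g" "g \<noteq> \<zero>" for g
  proof (rule ccontr)
    assume "g \<noteq> e"
    moreover have "g \<noteq> \<one>"
      using g e by auto
    moreover have "g \<otimes> e \<otimes> g = g"
      using g e by (metis m_comm)
    moreover have "\<one> \<noteq> \<zero>"
      using e one_zeroD by blast
    ultimately show False
      using no_3[of e \<one> g] g e by auto
  qed
  have square: "z \<otimes> z = e" if z: "z \<in> carrier R" "e \<otimes> z = z" "z \<noteq> \<zero>" for z
  proof (rule ccontr)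
    assume "z \<otimes> z \<noteq> e"
    obtain w where w: "w \<in> carrier R" "z \<otimes> w \<otimes> z = z"
      using regular z(1) by (auto simp: von_neumann_regular_def)
    have "z \<otimes> w = e"
    proof (rule minimal)
      show "z \<otimes> w \<otimes> (z \<otimes> w) = z \<otimes> w"
        using w z(1) by (simp add: m_assoc[symmetric])
      show "e \<otimes> (z \<otimes> w) = z \<otimes> w"
        using w z e by (simp add: m_assoc[symmetric])
      show "z \<otimes> w \<noteq> \<zero>"
        using w z by auto
    qed (use w z in auto)
    define y where "y = e \<otimes> w"
    have y: "y \<in> carrier R" "e \<otimes> y = y" "z \<otimes> y = e"
      using w z e \<open>z \<otimes> w = e\<close> by (simp_all add: y_def m_lcomm) (simp add: m_assoc[symmetric])
    have fz: "f \<otimes> z = \<zero>" "f \<otimes> y = \<zero>"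
      using f e z y by (metis l_null m_assoc m_comm)+
    then have zf: "z \<otimes> f = \<zero>" "y \<otimes> f = \<zero>"
      using f(1) z(1) y(1) by (simp_all add: m_comm)
    \<comment> \<open>Adding \<open>f\<close> turns inverses in the corner eR into mutually inverse
      units of R, which are adjacent. Each of them is fixed to \<open>f\<close> on multiplication by
      \<open>f\<close>, hence is also adjacent to \<open>f\<close>.\<close>
    have inverse: "(z \<oplus> f) \<otimes> (y \<oplus> f) = \<one>"
      using z(1) y(1,3) e(1) f fz zf by (simp add: l_distr r_distr)
    have f_mult: "f \<otimes> (z \<oplus> f) = f" "f \<otimes> (y \<oplus> f) = f"
      using z(1) y(1) f fz by (simp_all add: r_distr)
    have "z \<oplus> f \<noteq> y \<oplus> f"
      using z(1) y(1,3) f(1) \<open>z \<otimes> z \<noteq> e\<close> by auto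
    moreover have "y \<oplus> f \<noteq> f" "f \<noteq> z \<oplus> f"
      using y z e f(1) by (auto simp: add.l_cancel_one add.l_cancel_one')
    moreover have "z \<oplus> f \<noteq> \<zero>" "y \<oplus> f \<noteq> \<zero>"
      using f_mult f \<open>f \<noteq> \<zero>\<close> by auto
    ultimately show False
      using no_3[of "z \<oplus> f" "y \<oplus> f" f] z(1) y(1) f(1,2) \<open>f \<noteq> \<zero>\<close> inverse f_mult
      by simp
  qed
  show ?thesis
  proof (rule ccontr)
    assume not: "e \<otimes> x \<notin> {\<zero>, e, \<ominus> e}"
    define z where "z = e \<otimes> x"
    have z: "z \<in> carrier R" "e \<otimes> z = z" "z \<noteq> \<zero>" "z \<noteq> e" "z \<noteq> \<ominus> e"
      using not x e by (auto simp: z_def m_assoc[symmetric])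
    define u where "u = z \<ominus> e"
    have u: "u \<in> carrier R" "e \<otimes> u = u" "u \<noteq> \<zero>"
      using z e sum_zero_eq_neg[of z "\<ominus> e"] by (auto simp: u_def minus_eq r_distr r_minus)
    have "u \<otimes> (z \<oplus> e) = z \<otimes> z \<ominus> e \<otimes> e"
      using z(1) e(1) unfolding u_def by algebra
    also have "\<dots> = \<zero>"
      using square[OF z(1-3)] e by (simp add: minus_eq r_neg)
    finally have "u \<otimes> (z \<oplus> e) = \<zero>" .
    then have "u \<otimes> u \<otimes> (z \<oplus> e) = \<zero>"
      using u z e by (simp add: m_assoc)
    then have "z \<oplus> e = \<zero>"
      using square[OF u] z e by (simp add: r_distr)
    then show False
      using z e by (simp add: sum_zero_eq_neg)
  qed
qed

section \<open>Cyclic corners and the splitting of the ring\<close>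

lemma add_pow_int_mod:
  fixes i m :: int
  assumes "x \<in> carrier R" "add_pow R m x = \<zero>"
  shows "add_pow R (i mod m) x = add_pow R i x"
proof -
  have "add_pow R i x = add_pow R (m * (i div m) + i mod m) x" by simp
  also have "\<dots> = add_pow R (m * (i div m)) x \<oplus> add_pow R (i mod m) x"
    using assms(1) by (rule add.int_pow_mult)
  also have "add_pow R (m * (i div m)) x = add_pow R (i div m) (add_pow R m x)"
    using assms(1) by (simp add: add.int_pow_pow)
  finally show ?thesis using assms by simp
qed

text \<open>For m > 0 this expresses that the corner eR, with identity \<open>e\<close>, is a copy
  of the integers modulo m via i \<mapsto> i e, without building eR as a separate ring.\<close>

definition cyclic_corner :: "int \<Rightarrow> 'a \<Rightarrow> bool" where
  "cyclic_corner m e \<longleftrightarrow> e \<in> carrier R \<and> e \<otimes> e = e \<and> add_pow R m e = \<zero> \<and>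
     inj_on (\<lambda>i::int. add_pow R i e) {0..m - 1} \<and>
     (\<forall>x \<in> carrier R. \<exists>i \<in> {0..m - 1}. e \<otimes> x = add_pow R i e)"

lemma cyclic_corner_2_or_3:
  assumes e: "e \<in> carrier R" "e \<otimes> e = e" "e \<noteq> \<zero>"
    and corner: "\<And>x. x \<in> carrier R \<Longrightarrow> e \<otimes> x \<in> {\<zero>, e, \<ominus> e}"
  shows "cyclic_corner 2 e \<or> cyclic_corner 3 e"
proof -
  have zero: "add_pow R (0::int) e = \<zero>"
    by (simp add: add_pow_def)
  have two: "add_pow R (2::int) e = e \<oplus> e"
    using add.int_pow_mult[of e 1 1] e by simp
  show ?thesis
  proof (cases "\<ominus> e = e")
    case True
    then have "add_pow R (2::int) e = \<zero>"
      using e two r_neg[of e] by simp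
    moreover have "{0..2 - 1::int} = {0, 1}" by auto
    ultimately have "cyclic_corner 2 e"
      using e corner True zero by (simp add: cyclic_corner_def)
    then show ?thesis ..
  next
    case False
    \<comment> \<open>The element e + e = e(1 + 1) lies in the corner. It is neither 0, as -e
      \<noteq> e, nor \<open>e\<close>, as e \<noteq> 0; so it is -e, and 3e = 0.\<close>
    have "e \<oplus> e \<in> {\<zero>, e, \<ominus> e}"
      using corner[of "\<one> \<oplus> \<one>"] e by (simp add: r_distr)
    moreover have "e \<oplus> e \<noteq> \<zero>"
      using False e minus_equality by blast
    ultimately have double: "add_pow R (2::int) e = \<ominus> e"
      using e two by auto
    have "add_pow R (3::int) e = add_pow R (2::int) e \<oplus> e"
      using add.int_pow_mult[of e 2 1] e by simp
    then have "add_pow R (3::int) e = \<zero>"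
      using double e by (simp add: l_neg)
    moreover have "{0..3 - 1::int} = {0, 1, 2}" by auto
    moreover have "\<zero> \<noteq> \<ominus> e" using e by (metis minus_minus minus_zero)
    ultimately have "cyclic_corner 3 e"
      using e corner False double zero by (auto simp: cyclic_corner_def)
    then show ?thesis ..
  qed
qed

text \<open>This is the Peirce decomposition R = eR \<times> fR for complementary idempotents, with
  each corner identified with a residue ring.\<close>

lemma iso_residue_prod:
  assumes "1 < m" "1 < n" and e: "cyclic_corner m e" and f: "cyclic_corner n f"
    and ef: "e \<otimes> f = \<zero>" "e \<oplus> f = \<one>"
  shows "R \<simeq> residue_prod m n"
proof -
  note [simp] = add.int_pow_closed
  have e': "e \<in> carrier R" "e \<otimes> e = e" "add_pow R m e = \<zero>" "inj_on (\<lambda>i::int. add_pow R i e) {0..m - 1}"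
      "\<And>x. x \<in> carrier R \<Longrightarrow> \<exists>i \<in> {0..m - 1}. e \<otimes> x = add_pow R i e"
    and f': "f \<in> carrier R" "f \<otimes> f = f" "add_pow R n f = \<zero>" "inj_on (\<lambda>i::int. add_pow R i f) {0..n - 1}"
      "\<And>x. x \<in> carrier R \<Longrightarrow> \<exists>i \<in> {0..n - 1}. f \<otimes> x = add_pow R i f"
    using e f by (auto simp: cyclic_corner_def)
  have fe: "f \<otimes> e = \<zero>"
    using ef(1) e'(1) f'(1) by (simp add: m_comm)
  define h where "h = (\<lambda>(i::int, j::int). add_pow R i e \<oplus> add_pow R j f)"
  have h_closed: "h v \<in> carrier R" for v
    using e'(1) f'(1) by (simp add: h_def split: prod.split)
  have h_e: "e \<otimes> h v = add_pow R (fst v) e" and h_f: "f \<otimes> h v = add_pow R (snd v) f" for v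
    using e'(1,2) f'(1,2) ef(1) fe
    by (simp_all add: h_def r_distr add_pow_rdistr_int split: prod.split)
  have decompose: "x = e \<otimes> x \<oplus> f \<otimes> x" if "x \<in> carrier R" for x
    using ef(2) e'(1) f'(1) that by (simp add: l_distr[symmetric])
  \<comment> \<open>An element is determined by its components in eR and fR. The homomorphism laws
    and surjectivity are thereby reduced to comparing multiples of \<open>e\<close> and of
    \<open>f\<close>.\<close>
  have h_unique: "x = h v" if "x \<in> carrier R" "e \<otimes> x = add_pow R (fst v) e" "f \<otimes> x = add_pow R (snd v) f" for x v
    using decompose[OF that(1)] that(2,3) by (simp add: h_def split_beta)
  have "h \<in> ring_iso (residue_prod m n) R"
  proof (rule ring_iso_memI)
    show "h v \<in> carrier R" for v by (rule h_closed)
    show "h (v \<otimes>\<^bsub>residue_prod m n\<^esub> w) = h v \<otimes> h w" for v w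
    proof (rule h_unique[symmetric])
      have "e \<otimes> (h v \<otimes> h w) = add_pow R (fst v) (e \<otimes> h w)"
        using e'(1) h_closed h_e by (simp add: m_assoc[symmetric] add_pow_ldistr_int)
      also have "\<dots> = add_pow R (fst v * fst w) e"
        using e'(1) by (simp add: h_e add.int_pow_pow mult.commute)
      finally show "e \<otimes> (h v \<otimes> h w) = add_pow R (fst (v \<otimes>\<^bsub>residue_prod m n\<^esub> w)) e"
        using e'(1,3) by (simp add: residue_prod_simps add_pow_int_mod)
      have "f \<otimes> (h v \<otimes> h w) = add_pow R (snd v) (f \<otimes> h w)"
        using f'(1) h_closed h_f by (simp add: m_assoc[symmetric] add_pow_ldistr_int)
      also have "\<dots> = add_pow R (snd v * snd w) f"
        using f'(1) by (simp add: h_f add.int_pow_pow mult.commute)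
      finally show "f \<otimes> (h v \<otimes> h w) = add_pow R (snd (v \<otimes>\<^bsub>residue_prod m n\<^esub> w)) f"
        using f'(1,3) by (simp add: residue_prod_simps add_pow_int_mod)
    qed (simp add: h_closed)
    show "h (v \<oplus>\<^bsub>residue_prod m n\<^esub> w) = h v \<oplus> h w" for v w
      by (rule h_unique[symmetric])
        (use e'(1,3) f'(1,3) h_closed in \<open>simp_all add: residue_prod_simps add_pow_int_mod r_distr
           h_e h_f add.int_pow_mult\<close>)
    show "h \<one>\<^bsub>residue_prod m n\<^esub> = \<one>"
      using e'(1) f'(1) ef(2) by (simp add: residue_prod_simps h_def)
    show "bij_betw h (carrier (residue_prod m n)) (carrier R)"
    proof (rule bij_betw_imageI)
      show "inj_on h (carrier (residue_prod m n))"
      proof (rule inj_onI)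
        fix v w assume vw: "v \<in> carrier (residue_prod m n)" "w \<in> carrier (residue_prod m n)" "h v = h w"
        have "fst v = fst w"
        proof (rule inj_onD[OF e'(4)])
          show "add_pow R (fst v) e = add_pow R (fst w) e"
            using h_e[of v] h_e[of w] vw(3) by simp
        qed (use vw in \<open>auto simp: residue_prod_simps\<close>)
        moreover have "snd v = snd w"
        proof (rule inj_onD[OF f'(4)])
          show "add_pow R (snd v) f = add_pow R (snd w) f"
            using h_f[of v] h_f[of w] vw(3) by simp
        qed (use vw in \<open>auto simp: residue_prod_simps\<close>)
        ultimately show "v = w"
          by (rule prod_eqI)
      qed
      show "h ` carrier (residue_prod m n) = carrier R"
      proof
        show "carrier R \<subseteq> h ` carrier (residue_prod m n)"
        proof
          fix x assume x: "x \<in> carrier R"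
          obtain i j where "i \<in> {0..m - 1}" "e \<otimes> x = add_pow R i e" "j \<in> {0..n - 1}" "f \<otimes> x = add_pow R j f"
            using e'(5)[OF x] f'(5)[OF x] by blast
          then show "x \<in> h ` carrier (residue_prod m n)"
            using h_unique[OF x, of "(i, j)"] by (auto simp: residue_prod_simps)
        qed
      qed (use h_closed in auto)
    qed
  qed
  \<comment> \<open>The map \<open>h\<close> runs from the product of residue rings to R, so the
    isomorphism has to be inverted.\<close>
  then show ?thesis
    using ring_iso_sym[OF ring_residue_prod[OF assms(1,2)]] by (auto simp: is_ring_iso_def)
qed

lemma iso_of_triangle_free:
  assumes regular: "von_neumann_regular R" and no_triangle: "girth (regular_graph R) \<noteq> 3"
    and e: "e \<in> carrier R" "e \<otimes> e = e" "e \<noteq> \<zero>" "e \<noteq> \<one>"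
  shows "R \<simeq> residue_prod 2 2 \<or> R \<simeq> residue_prod 2 3 \<or> R \<simeq> residue_prod 3 3"
proof -
  define f where "f = \<one> \<ominus> e"
  have f: "f \<in> carrier R" "f \<otimes> f = f" "e \<otimes> f = \<zero>" "e \<oplus> f = \<one>"
    using idempotent_complement[OF e(1,2)] e(1) by (simp_all add: f_def)
  then have f': "f \<otimes> e = \<zero>" "f \<oplus> e = \<one>" "f \<noteq> \<zero>" "f \<noteq> \<one>"
    using e by (auto simp: m_comm a_comm)
  have "cyclic_corner 2 e \<or> cyclic_corner 3 e"
    using cyclic_corner_2_or_3[OF e(1-3) corner_of_triangle_free[OF regular no_triangle e]] .
  moreover have "cyclic_corner 2 f \<or> cyclic_corner 3 f"
    using cyclic_corner_2_or_3[OF f(1,2) f'(3) corner_of_triangle_free[OF regular no_triangle f(1,2) f'(3,4)]] .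
  \<comment> \<open>When \<open>e\<close> has order 3 and \<open>f\<close> has order 2, exchanging
    the two idempotents yields \<open>residue_prod 2 3\<close> again.\<close>
  ultimately show ?thesis
    using iso_residue_prod[of _ _ e f] iso_residue_prod[of _ _ f e] f f' by fastforce
qed

end

theorem corollary2:
  fixes R :: "('a, 'b) ring_scheme"
  assumes "cring R"
    and "finite (carrier R)"
    and "von_neumann_regular R"
    and "nontrivial_graph (regular_graph R)"
    and "Digraph_Component.connected (with_proj (regular_graph R))"
  shows "girth (regular_graph R) =
    (if R \<simeq> RDirProd (residue_ring 2) (residue_ring 2) \<or>
        R \<simeq> RDirProd (residue_ring 2) (residue_ring 3) then \<infinity>
     else if R \<simeq> RDirProd (residue_ring 3) (residue_ring 3) then 8
     else 3)"
proof -
  interpret cring R by fact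
  have iso: "girth (regular_graph R) = girth (regular_graph (residue_prod m n))"
    if "R \<simeq> residue_prod m n" "1 < m" "1 < n" for m n
    using girth_regular_graph_ring_iso[OF ring_axioms ring_residue_prod] that by blast
  obtain u v where uv: "u \<in> pverts (regular_graph R)" "v \<in> pverts (regular_graph R)" "u \<noteq> v"
    using assms(4) by (auto simp: nontrivial_graph_def)
  \<comment> \<open>In the zero ring there would be no nonzero vertex, so 1 \<noteq> 0.\<close>
  then have "\<one>\<^bsub>R\<^esub> \<in> pverts (regular_graph R)"
    by (auto simp: regular_graph_def dest: one_zeroD)
  then obtain w where "(\<one>\<^bsub>R\<^esub>, w) \<in> parcs (regular_graph R) \<or> (w, \<one>\<^bsub>R\<^esub>) \<in> parcs (regular_graph R)"
    using connected_imp_neighbour[OF assms(5)] uv by metis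
  \<comment> \<open>If the girth is not 3, then R is one of the exceptional rings. If it is 3, then
    R is none of them, because their girths are \<infinity> and 8 and girth is invariant under
    isomorphism.\<close>
  from iso_of_triangle_free[OF assms(3) _ idempotent_of_one_arc[OF this]] show ?thesis
    using iso[of 2 2] iso[of 2 3] iso[of 3 3]
    by (auto simp: girth_residue_prod_2_2 girth_residue_prod_2_3 girth_residue_prod_3_3)
qed

end
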